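(* Let $X$ be a Banach space and let $T\in B(X)$. If $T$ is mean Li-Yorke chaotic, then $T$ is reiteratively distributionally chaotic of type $1^+$.
   Context: $B(X)$ is the space of bounded linear operators $X\to X$. $T$ is mean Li-Yorke chaotic if there is an uncountable set $S\subset X$ such that for every pair $(x,y)$ of distinct points of $S$, $\liminf_{N\to\infty}\frac1N\sum_{j=1}^N\|T^jx-T^jy\|=0$ and $\limsup_{N\to\infty}\frac1N\sum_{j=1}^N\|T^jx-T^jy\|>0$. For $A\subset\mathbb N$, $\overline{\mathrm{dens}}(A)=\limsup_{n\to\infty}\frac{\mathrm{card}(A\cap[1,n])}{n}$ and $\underline{\mathrm{Bd}}(A)=\lim_{n\to\infty}\liminf_{m\to\infty}\frac{\mathrm{card}(A\cap[m+1,m+n])}{n}$. For $x,y\in X$ and $\delta>0$ put $D_{x,y}(\delta)=\{j\in\mathbb N:\|T^jx-T^jy\|<\delta\}$, $F^*_{x,y}(\delta)=\overline{\mathrm{dens}}(D_{x,y}(\delta))$ and $BF_{x,y}(\delta)=\underline{\mathrm{Bd}}(D_{x,y}(\delta))$. $T$ is reiteratively distributionally chaotic of type $1^+$ if there exist an uncountable $\Gamma\subset X$ and $\varepsilon>0$ such that for all distinct $x,y\in\Gamma$, $BF_{x,y}(\varepsilon)=0$ and $F^*_{x,y}(\delta)=1$ for all $\delta>0$. *)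

theory Defs
  imports "HOL-Analysis.Analysis"
begin

text \<open>
  The limits superior and inferior below are taken in \<^typ>\<open>ereal\<close>, since the averages along an
  orbit may be unbounded. Spaces are real: a complex Banach space is a real one by restriction of
  scalars, its bounded complex-linear operators are bounded real-linear ones, and neither notion
  of chaos mentions the scalar field.
\<close>

definition orbit_mean :: "('a::real_normed_vector \<Rightarrow> 'a) \<Rightarrow> 'a \<Rightarrow> 'a \<Rightarrow> nat \<Rightarrow> real" where
  "orbit_mean T x y N = (1 / real N) * (\<Sum>j = 1..N. norm ((T ^^ j) x - (T ^^ j) y))"

definition mean_Li_Yorke_chaotic :: "('a::real_normed_vector \<Rightarrow> 'a) \<Rightarrow> bool" where
  "mean_Li_Yorke_chaotic T \<longleftrightarrow>
     (\<exists>S. uncountable S \<and>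
        (\<forall>x\<in>S. \<forall>y\<in>S. x \<noteq> y \<longrightarrow>
           liminf (\<lambda>N. ereal (orbit_mean T x y N)) = 0 \<and>
           limsup (\<lambda>N. ereal (orbit_mean T x y N)) > 0))"

definition upper_dens :: "nat set \<Rightarrow> ereal" where
  "upper_dens A = limsup (\<lambda>n. ereal (real (card (A \<inter> {1..n})) / real n))"

definition lower_block_freq :: "nat set \<Rightarrow> nat \<Rightarrow> ereal" where
  "lower_block_freq A n = liminf (\<lambda>m. ereal (real (card (A \<inter> {m + 1..m + n})) / real n))"

text \<open>
  The outer limit always exists, because \<open>n\<close> times the lower block frequency of length \<open>n\<close> is
  superadditive in \<open>n\<close> and the frequencies lie between \<open>0\<close> and \<open>1\<close>.
\<close>

definition lower_Banach_dens :: "nat set \<Rightarrow> ereal" where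
  "lower_Banach_dens A = lim (lower_block_freq A)"

definition close_times ::
    "('a::real_normed_vector \<Rightarrow> 'a) \<Rightarrow> 'a \<Rightarrow> 'a \<Rightarrow> real \<Rightarrow> nat set" where
  "close_times T x y \<delta> = {j. norm ((T ^^ j) x - (T ^^ j) y) < \<delta>}"

definition F_star :: "('a::real_normed_vector \<Rightarrow> 'a) \<Rightarrow> 'a \<Rightarrow> 'a \<Rightarrow> real \<Rightarrow> ereal" where
  "F_star T x y \<delta> = upper_dens (close_times T x y \<delta>)"

definition BF :: "('a::real_normed_vector \<Rightarrow> 'a) \<Rightarrow> 'a \<Rightarrow> 'a \<Rightarrow> real \<Rightarrow> ereal" where
  "BF T x y \<delta> = lower_Banach_dens (close_times T x y \<delta>)"

definition reiteratively_distributionally_chaotic_1_plus ::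
    "('a::real_normed_vector \<Rightarrow> 'a) \<Rightarrow> bool" where
  "reiteratively_distributionally_chaotic_1_plus T \<longleftrightarrow>
     (\<exists>\<Gamma> \<epsilon>. uncountable \<Gamma> \<and> \<epsilon> > 0 \<and>
        (\<forall>x\<in>\<Gamma>. \<forall>y\<in>\<Gamma>. x \<noteq> y \<longrightarrow>
           BF T x y \<epsilon> = 0 \<and> (\<forall>\<delta>>0. F_star T x y \<delta> = 1)))"

end

theory Submission
  imports Defs
begin

text \<open>
  It suffices to find one vector \<open>v\<close> with unbounded orbit whose orbital averages have lower limit
  zero: the scrambled set is then the line spanned by \<open>v\<close>. By Markov's inequality the small
  averages give close times of upper density one. Since \<open>T\<close> expands norms by at most a constant
  factor, a very large value in the orbit is preceded by a long block of large values, so an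
  unbounded orbit makes the lower Banach density of the close times vanish.

  Let \<open>u\<close> be the difference of a mean Li-Yorke pair, let the averages of \<open>u\<close> tend to zero along
  the times \<open>r k\<close>, and let \<open>Y\<close> be the closure of the subspace of all vectors with this property.
  Vectors with small averages are generic in \<open>Y\<close>. The powers of \<open>T\<close> are not uniformly bounded on
  \<open>Y\<close>, since otherwise the orbit of \<open>u\<close> would tend to zero, and so would its averages;
  hence vectors with unbounded orbit are generic in \<open>Y\<close> as well, and Baire's theorem gives \<open>v\<close>.
\<close>

section \<open>Iterates of operators and closures of subspaces\<close>

lemma bounded_linear_funpow:
  fixes T :: "'a::real_normed_vector \<Rightarrow> 'a"
  assumes "bounded_linear T"
  shows "bounded_linear (T ^^ n)"
proof (induction n)
  case 0
  then show ?case by (simp add: id_def bounded_linear_ident)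
next
  case (Suc n)
  then show ?case using bounded_linear_compose[OF assms Suc] by (simp add: o_def)
qed

lemma subspace_closure:
  fixes S :: "'a::real_normed_vector set"
  assumes "subspace S"
  shows "subspace (closure S)"
proof (rule subspaceI)
  show "0 \<in> closure S" using subspace_0[OF assms] closure_subset by blast
  show "x + y \<in> closure S" if xy: "x \<in> closure S" "y \<in> closure S" for x y
  proof -
    obtain f g where "\<And>n. f n \<in> S" "f \<longlonglongrightarrow> x" "\<And>n. g n \<in> S" "g \<longlonglongrightarrow> y"
      using xy by (auto simp: closure_sequential)
    then show ?thesis unfolding closure_sequential
      by (intro exI[of _ "\<lambda>n. f n + g n"]) (auto intro: tendsto_add subspace_add[OF assms])
  qed
  show "c *\<^sub>R x \<in> closure S" if x: "x \<in> closure S" for c x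
  proof -
    obtain f where "\<And>n. f n \<in> S" "f \<longlonglongrightarrow> x" using x by (auto simp: closure_sequential)
    then show ?thesis unfolding closure_sequential
      by (intro exI[of _ "\<lambda>n. c *\<^sub>R f n"]) (auto intro: tendsto_scaleR subspace_scale[OF assms])
  qed
qed

section \<open>Densities of sublevel sets of a sequence\<close>

lemma upper_dens_le_1: "upper_dens A \<le> 1"
  unfolding upper_dens_def
proof (intro Limsup_bounded always_eventually allI)
  fix n :: nat
  have "card (A \<inter> {1..n}) \<le> card {1..n}" by (intro card_mono) auto
  then show "ereal (real (card (A \<inter> {1..n})) / real n) \<le> 1"
    by (cases "n = 0") (auto simp: field_simps)
qed

text \<open>Markov's inequality: if more than a share \<open>1 - c\<close> of the indices in
  \<open>{1..N}\<close> satisfy \<open>a j \<ge> \<delta>\<close>, the average exceeds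
  \<open>\<delta> * (1 - c)\<close>. An upper density below \<open>c < 1\<close> would make this
  happen for all large \<open>N\<close>.\<close>

lemma upper_dens_eq_1:
  fixes a :: "nat \<Rightarrow> real"
  assumes nonneg: "\<And>j. 0 \<le> a j" and "0 < \<delta>"
    and small: "\<And>e. 0 < e \<Longrightarrow> \<exists>\<^sub>F N in sequentially. (\<Sum>j=1..N. a j) / real N < e"
  shows "upper_dens {j. a j < \<delta>} = 1"
proof (rule antisym[OF upper_dens_le_1], rule ccontr)
  let ?A = "{j. a j < \<delta>}"
  assume "\<not> 1 \<le> upper_dens ?A"
  then have "upper_dens ?A < 1" by simp
  then obtain c where c: "upper_dens ?A < ereal c" "c < 1"
    by (metis ereal_dense2 less_ereal.simps(1) one_ereal_def)
  have ev: "\<forall>\<^sub>F n in sequentially. ereal (real (card (?A \<inter> {1..n})) / real n) < ereal c"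
    using c(1) unfolding upper_dens_def by (rule Limsup_lessD)
  have "\<exists>\<^sub>F N in sequentially. (\<Sum>j=1..N. a j) / real N < \<delta> * (1 - c)"
    using small[of "\<delta> * (1 - c)"] \<open>0 < \<delta>\<close> c by simp
  then have "\<exists>\<^sub>F N in sequentially. (\<Sum>j=1..N. a j) / real N < \<delta> * (1 - c) \<and>
      (ereal (real (card (?A \<inter> {1..N})) / real N) < ereal c \<and> 0 < N)"
    by (rule frequently_eventually_frequently)
      (intro eventually_conj ev eventually_gt_at_top)
  then obtain N where N: "real (card (?A \<inter> {1..N})) / real N < c" "0 < N"
      "(\<Sum>j=1..N. a j) / real N < \<delta> * (1 - c)"
    using frequently_ex[of _ sequentially] by auto
  have "card {1..N} = card (?A \<inter> {1..N}) + card ({1..N} - ?A)"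
    by (metis Int_commute card_Int_Diff finite_atLeastAtMost)
  then have "real N * (1 - c) < real (card ({1..N} - ?A))"
    using N by (simp add: field_simps)
  then have "\<delta> * (real N * (1 - c)) < \<delta> * real (card ({1..N} - ?A))"
    using \<open>0 < \<delta>\<close> by simp
  also have "\<dots> = (\<Sum>j\<in>{1..N} - ?A. \<delta>)" by simp
  also have "\<dots> \<le> (\<Sum>j\<in>{1..N} - ?A. a j)" by (intro sum_mono) auto
  also have "\<dots> \<le> (\<Sum>j=1..N. a j)" by (intro sum_mono2) (auto simp: nonneg)
  finally show False using N by (simp add: field_simps)
qed

text \<open>The growth bound read backwards: \<open>a j \<le> M ^ (j - i) * a i\<close> for
  \<open>i \<le> j\<close>, so a huge value at \<open>j\<close> keeps the \<open>n\<close> indices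
  up to \<open>j\<close> out of the set. Such blocks occur arbitrarily late for each
  \<open>n\<close>, so every block frequency already vanishes, not only their limit.\<close>

lemma lower_Banach_dens_eq_0:
  fixes a :: "nat \<Rightarrow> real"
  assumes "1 \<le> M" "0 < \<epsilon>" and growth: "\<And>j. a (Suc j) \<le> M * a j"
    and unbounded: "\<And>K. \<exists>j. K < a j"
  shows "lower_Banach_dens {j. a j < \<epsilon>} = 0"
proof -
  let ?A = "{j. a j < \<epsilon>}"
  have pow: "a (i + k) \<le> M ^ k * a i" for i k
  proof (induction k)
    case (Suc k)
    have "a (i + Suc k) \<le> M * a (i + k)" using growth[of "i + k"] by simp
    also have "\<dots> \<le> M * (M ^ k * a i)" using Suc \<open>1 \<le> M\<close> by (intro mult_left_mono) auto
    finally show ?case by (simp add: mult.assoc)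
  qed simp
  have block: "\<exists>m\<ge>m0. ?A \<inter> {m+1..m+n} = {}" for n m0
  proof -
    \<comment> \<open>The first entry makes \<open>a j\<close> large enough for a block of length
      \<open>n\<close> ending at \<open>j\<close>; the others force \<open>j > m0 + n\<close>, so
      that this block starts after \<open>m0\<close>.\<close>
    define K where "K = Max (insert (\<epsilon> * M ^ n) (a ` {..m0 + n}))"
    obtain j where j: "K < a j" using unbounded by blast
    have K: "\<epsilon> * M ^ n < a j" "\<And>i. i \<le> m0 + n \<Longrightarrow> a i < a j"
      using j by (auto simp: K_def)
    then have jgt: "m0 + n < j" by (meson less_irrefl not_le)
    have "\<epsilon> \<le> a i" if i: "j - n + 1 \<le> i" "i \<le> j - n + n" for i
    proof -
      have "a (i + (j - i)) \<le> M ^ (j - i) * a i" by (rule pow)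
      then have "\<epsilon> * M ^ n < M ^ (j - i) * a i" using K(1) i jgt by simp
      moreover have "\<epsilon> * M ^ (j - i) \<le> \<epsilon> * M ^ n"
        using i jgt \<open>1 \<le> M\<close> \<open>0 < \<epsilon>\<close> by (intro mult_left_mono power_increasing) auto
      ultimately have "M ^ (j - i) * \<epsilon> < M ^ (j - i) * a i" by (simp add: mult.commute)
      then show ?thesis using \<open>1 \<le> M\<close> by simp
    qed
    then have "?A \<inter> {j - n + 1..j - n + n} = {}" by (fastforce simp: not_less)
    then show ?thesis using jgt by (intro exI[of _ "j - n"]) auto
  qed
  have "lower_block_freq ?A n = 0" for n
    unfolding lower_block_freq_def
  proof (rule antisym)
    show "0 \<le> liminf (\<lambda>m. ereal (real (card (?A \<inter> {m + 1..m + n})) / real n))"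
      by (intro Liminf_bounded always_eventually) auto
    show "liminf (\<lambda>m. ereal (real (card (?A \<inter> {m + 1..m + n})) / real n)) \<le> 0"
    proof (rule ccontr)
      assume "\<not> ?thesis"
      then have "0 < liminf (\<lambda>m. ereal (real (card (?A \<inter> {m + 1..m + n})) / real n))" by simp
      then have "\<forall>\<^sub>F m in sequentially. 0 < ereal (real (card (?A \<inter> {m + 1..m + n})) / real n)"
        by (rule less_LiminfD)
      then obtain m0 where "\<And>m. m \<ge> m0 \<Longrightarrow> 0 < ereal (real (card (?A \<inter> {m + 1..m + n})) / real n)"
        unfolding eventually_sequentially by blast
      with block[of m0 n] show False by force
    qed
  qed
  then have "lower_block_freq ?A = (\<lambda>n. 0)" by auto
  then show ?thesis unfolding lower_Banach_dens_def by (simp add: limI)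
qed

section \<open>Averages, Baire category and the existence of a suitable vector\<close>

lemma averages_tendsto_0:
  fixes a :: "nat \<Rightarrow> real"
  assumes "a \<longlonglongrightarrow> 0" "\<And>j. 0 \<le> a j"
  shows "(\<lambda>N. (\<Sum>j=1..N. a j) / real N) \<longlonglongrightarrow> 0"
proof (rule LIMSEQ_I)
  fix e :: real assume "0 < e"
  obtain n0 where "\<And>j. j \<ge> n0 \<Longrightarrow> norm (a j - 0) < e / 2"
    using LIMSEQ_D[OF assms(1), of "e / 2"] \<open>0 < e\<close> by auto
  then have n0: "a j \<le> e / 2" if "j \<ge> n0" for j
    using that by (force intro: less_imp_le)
  define C where "C = (\<Sum>j<n0. a j)"
  obtain N0 where N0: "2 * C / e < real N0" using reals_Archimedean2 by blast
  have "norm ((\<Sum>j=1..N. a j) / real N - 0) < e" if "N \<ge> Suc N0" for N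
  proof -
    \<comment> \<open>The sum is split at \<open>n0\<close>. The head \<open>C\<close> may include
      the index 0, which only increases it, and \<open>N0\<close> was chosen to make
      \<open>C\<close> less than \<open>N * e / 2\<close>.\<close>
    have "(\<Sum>j=1..N. a j) \<le> (\<Sum>j\<in>{..<n0} \<union> {max 1 n0..N}. a j)"
      by (intro sum_mono2) (auto simp: assms(2))
    also have "\<dots> = C + (\<Sum>j=max 1 n0..N. a j)"
      unfolding C_def by (intro sum.union_disjoint) auto
    also have "(\<Sum>j=max 1 n0..N. a j) \<le> (\<Sum>j=max 1 n0..N. e / 2)"
      by (intro sum_mono n0) auto
    also have "\<dots> \<le> (\<Sum>j=1..N. e / 2)"
      using \<open>0 < e\<close> by (intro sum_mono2) auto
    also have "C + \<dots> < real N * e"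
    proof -
      have "2 * C / e < real N" using N0 that by linarith
      then show ?thesis using \<open>0 < e\<close> by (simp add: field_simps)
    qed
    finally have "(\<Sum>j=1..N. a j) / real N < e"
      using that by (simp add: divide_less_eq mult.commute)
    then show ?thesis by (simp add: assms(2) sum_nonneg)
  qed
  then show "\<exists>no. \<forall>N\<ge>no. norm ((\<Sum>j=1..N. a j) / real N - 0) < e" by blast
qed

text \<open>Baire's theorem inside a closed set: openness is meant in the whole space, density
  relative to \<open>Y\<close>. A countable index type allows two sequences of conditions to be
  combined.\<close>

lemma Baire_category_closed:
  fixes Y :: "'a::complete_space set" and G :: "'i::countable \<Rightarrow> 'a set"
  assumes "closed Y" "Y \<noteq> {}" and "\<And>i. open (G i)"
    and dense: "\<And>i y e. y \<in> Y \<Longrightarrow> 0 < e \<Longrightarrow> \<exists>z\<in>Y \<inter> G i. dist z y < e"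
  shows "\<exists>v\<in>Y. \<forall>i. v \<in> G i"
proof -
  let ?\<G> = "range (\<lambda>i. Y \<inter> G i)"
  have "(top_of_set Y) closure_of \<Inter>?\<G> = topspace (top_of_set Y)"
  proof (rule Baire_category)
    have "completely_metrizable_space (top_of_set Y)"
      using assms(1) by (intro completely_metrizable_space_closedin
          completely_metrizable_space_euclidean) auto
    then show "completely_metrizable_space (top_of_set Y)
        \<or> locally_compact_space (top_of_set Y) \<and> regular_space (top_of_set Y)" ..
    fix W assume "W \<in> ?\<G>"
    then obtain i where W: "W = Y \<inter> G i" by auto
    have "Y \<subseteq> closure (Y \<inter> G i)" using dense[of _ _ i] by (auto simp: closure_approachable)
    then show "openin (top_of_set Y) W \<and> (top_of_set Y) closure_of W = topspace (top_of_set Y)"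
      using assms(3) by (auto simp: W closure_of_subtopology Int_absorb1 openin_open)
  qed auto
  then have "\<Inter>?\<G> \<noteq> {}" using \<open>Y \<noteq> {}\<close> by auto
  then show ?thesis by auto
qed

text \<open>Otherwise one bound \<open>K\<close> serves all orbits starting in a ball of
  \<open>Y\<close>, and by linearity the iterates are uniformly bounded on \<open>Y\<close>. One
  iterate of \<open>u\<close> close to 0 would then keep all later ones close to 0.\<close>

lemma exists_unbounded_orbit_near:
  fixes T :: "'a::real_normed_vector \<Rightarrow> 'a"
  assumes T: "bounded_linear T" and Y: "subspace Y"
    and u: "\<And>i. (T ^^ i) u \<in> Y" "\<not> (\<lambda>j. norm ((T ^^ j) u)) \<longlonglongrightarrow> 0"
    and near0: "\<And>e. 0 < e \<Longrightarrow> \<exists>i. norm ((T ^^ i) u) < e"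
    and "y \<in> Y" "0 < e"
  shows "\<exists>z\<in>Y. dist z y < e \<and> (\<exists>n. K < norm ((T ^^ n) z))"
proof (rule ccontr)
  assume "\<not> ?thesis"
  then have bd: "norm ((T ^^ n) z) \<le> K" if "z \<in> Y" "dist z y < e" for z n
    using that by (meson not_less)
  have lin: "linear (T ^^ n)" for n
    using bounded_linear_funpow[OF T] bounded_linear.linear by blast
  \<comment> \<open>\<open>2 * K\<close> bounds the distance between two orbits from the ball, and
    \<open>2 / e\<close> rescales a displacement of norm \<open>e / 2\<close> to norm 1.\<close>
  define C where "C = 2 * K * (2 / e)"
  have "0 \<le> K" using order_trans[OF norm_ge_zero bd[OF \<open>y \<in> Y\<close>]] \<open>0 < e\<close> by auto
  then have "0 \<le> C" using \<open>0 < e\<close> by (simp add: C_def)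
  have C: "norm ((T ^^ n) z) \<le> C * norm z" if "z \<in> Y" for z n
  proof (cases "z = 0")
    case True
    then show ?thesis using linear_0[OF lin[of n]] by simp
  next
    case False
    define s where "s = e / 2 / norm z"
    have s: "0 < s" "norm (s *\<^sub>R z) < e" using False \<open>0 < e\<close> by (auto simp: s_def)
    have "(T ^^ n) (y + s *\<^sub>R z) - (T ^^ n) y = s *\<^sub>R (T ^^ n) z"
      by (simp add: linear_add[OF lin] linear_scale[OF lin])
    then have "s * norm ((T ^^ n) z) = norm ((T ^^ n) (y + s *\<^sub>R z) - (T ^^ n) y)"
      using s by simp
    also have "\<dots> \<le> norm ((T ^^ n) (y + s *\<^sub>R z)) + norm ((T ^^ n) y)" by (rule norm_triangle_ineq4)
    also have "\<dots> \<le> K + K"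
      using s \<open>y \<in> Y\<close> \<open>0 < e\<close> \<open>z \<in> Y\<close> Y
      by (intro add_mono bd) (auto simp: dist_norm subspace_add subspace_scale)
    finally show ?thesis using False \<open>0 < e\<close> by (simp add: s_def C_def field_simps)
  qed
  have "(\<lambda>j. norm ((T ^^ j) u)) \<longlonglongrightarrow> 0"
  proof (rule LIMSEQ_I)
    fix d :: real assume "0 < d"
    \<comment> \<open>\<open>C + 1\<close> instead of \<open>C\<close> avoids a division by
      zero.\<close>
    then obtain i where i: "norm ((T ^^ i) u) < d / (C + 1)" using near0[of "d / (C + 1)"] \<open>0 \<le> C\<close> by auto
    have "norm ((T ^^ j) u) < d" if "i \<le> j" for j
    proof -
      have "(T ^^ j) u = (T ^^ (j - i)) ((T ^^ i) u)"
        using that by (metis comp_apply funpow_add le_add_diff_inverse2)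
      then have "norm ((T ^^ j) u) \<le> C * norm ((T ^^ i) u)" using C[OF u(1)] by simp
      also have "\<dots> \<le> (C + 1) * norm ((T ^^ i) u)" by (intro mult_right_mono) auto
      also have "\<dots> < d" using i \<open>0 \<le> C\<close> by (simp add: field_simps)
      finally show ?thesis .
    qed
    then show "\<exists>no. \<forall>n\<ge>no. norm (norm ((T ^^ n) u) - 0) < d" by auto
  qed
  with u(2) show False ..
qed

lemma exists_unbounded_orbit_small_averages:
  fixes T :: "'a::banach \<Rightarrow> 'a"
  assumes T: "bounded_linear T" and r: "strict_mono r"
    and lim: "(\<lambda>k. (\<Sum>j=1..r k. norm ((T ^^ j) u)) / real (r k)) \<longlonglongrightarrow> 0"
    and not_lim: "\<not> (\<lambda>N. (\<Sum>j=1..N. norm ((T ^^ j) u)) / real N) \<longlonglongrightarrow> 0"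
  obtains v where "\<And>K. \<exists>n. K < norm ((T ^^ n) v)"
    and "\<And>e. 0 < e \<Longrightarrow> \<exists>\<^sub>F N in sequentially. (\<Sum>j=1..N. norm ((T ^^ j) v)) / real N < e"
proof -
  define m where "m y N = (\<Sum>j=1..N. norm ((T ^^ j) y)) / real N" for y N
  note bl = bounded_linear_funpow[OF T]
  have lin: "linear (T ^^ n)" for n using bl bounded_linear.linear by blast
  \<comment> \<open>The times \<open>r\<close> are the same for all vectors, which makes sums work:
    having lower limit zero is not in general preserved under addition.\<close>
  define Y0 where "Y0 = {y. (\<lambda>k. m y (r k)) \<longlonglongrightarrow> 0}"
  have m_nonneg: "0 \<le> m y N" for y N by (auto simp: m_def intro!: divide_nonneg_nonneg sum_nonneg)
  have m_add: "m (x + y) N \<le> m x N + m y N" for x y N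
    unfolding m_def add_divide_distrib[symmetric] sum.distrib[symmetric]
    by (intro divide_right_mono sum_mono) (auto simp: linear_add[OF lin] norm_triangle_ineq)
  have m_scale: "m (c *\<^sub>R x) N = \<bar>c\<bar> * m x N" for c x N
    by (simp add: m_def linear_scale[OF lin] sum_distrib_left)
  have Y0: "subspace Y0"
  proof (rule subspaceI)
    show "0 \<in> Y0" by (simp add: Y0_def m_def linear_0[OF lin])
    show "c *\<^sub>R x \<in> Y0" if "x \<in> Y0" for c x
      using that unfolding Y0_def by (auto simp: m_scale intro: tendsto_mult_right_zero)
    show "x + y \<in> Y0" if "x \<in> Y0" "y \<in> Y0" for x y
    proof -
      have "(\<lambda>k. m x (r k) + m y (r k)) \<longlonglongrightarrow> 0"
        using that tendsto_add[of _ 0 sequentially _ 0] by (simp add: Y0_def)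
      then have "(\<lambda>k. m (x + y) (r k)) \<longlonglongrightarrow> 0"
        by (rule Lim_null_comparison[rotated]) (simp add: m_nonneg m_add)
      then show ?thesis by (simp add: Y0_def)
    qed
  qed
  \<comment> \<open>Iterates commute, so the averages of \<open>(T ^^ i) u\<close> are at most those
    of \<open>u\<close> times a bound \<open>B\<close> for \<open>T ^^ i\<close>.\<close>
  have orbit: "(T ^^ i) u \<in> Y0" for i
  proof -
    obtain B where B: "\<And>x. norm ((T ^^ i) x) \<le> norm x * B"
      using bounded_linear.bounded[OF bl] by blast
    have "m ((T ^^ i) u) N \<le> B * m u N" for N
    proof -
      have "norm ((T ^^ j) ((T ^^ i) u)) \<le> B * norm ((T ^^ j) u)" for j
        using B[of "(T ^^ j) u"] by (metis add.commute comp_apply funpow_add mult.commute)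
      then show ?thesis
        unfolding m_def times_divide_eq_right sum_distrib_left
        by (intro divide_right_mono sum_mono) auto
    qed
    then have bound: "\<forall>\<^sub>F k in sequentially. norm (m ((T ^^ i) u) (r k)) \<le> B * m u (r k)"
      by (simp add: m_nonneg)
    have "(\<lambda>k. B * m u (r k)) \<longlonglongrightarrow> 0"
      using lim by (intro tendsto_mult_right_zero) (simp add: m_def)
    with bound have "(\<lambda>k. m ((T ^^ i) u) (r k)) \<longlonglongrightarrow> 0"
      by (rule Lim_null_comparison)
    then show ?thesis by (simp add: Y0_def)
  qed
  define Y where "Y = closure Y0"
  have Y: "subspace Y" "closed Y" "Y0 \<subseteq> Y"
    by (auto simp: Y_def closure_subset subspace_closure Y0)
  have small: "\<exists>N\<ge>k. m y N < e" if "y \<in> Y0" "0 < e" for y e k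
  proof -
    have "\<forall>\<^sub>F i in sequentially. m y (r i) < e"
      using that by (intro order_tendstoD) (auto simp: Y0_def)
    moreover have "\<forall>\<^sub>F i in sequentially. k \<le> r i"
      using r filterlim_at_top filterlim_subseq by blast
    ultimately show ?thesis
      using eventually_happens'[OF _ eventually_conj] trivial_limit_sequentially by blast
  qed
  \<comment> \<open>Contrapositive of Cesaro's theorem.\<close>
  have nonlim: "\<not> (\<lambda>j. norm ((T ^^ j) u)) \<longlonglongrightarrow> 0"
    using not_lim averages_tendsto_0[of "\<lambda>j. norm ((T ^^ j) u)"] by auto
  \<comment> \<open>A lower bound \<open>e\<close> on all iterates would pass to all averages,
    although these become small along \<open>r\<close>.\<close>
  have near0: "\<exists>i. norm ((T ^^ i) u) < e" if "0 < e" for e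
  proof (rule ccontr)
    assume "\<not> ?thesis"
    then have e: "e \<le> norm ((T ^^ i) u)" for i by (simp add: not_less)
    have "u \<in> Y0" using orbit[of 0] by simp
    then obtain N where N: "1 \<le> N" "m u N < e" using small[of u e 1] \<open>0 < e\<close> by auto
    have "(\<Sum>j=1..N. e) \<le> (\<Sum>j=1..N. norm ((T ^^ j) u))" by (intro sum_mono e)
    then show False using N by (simp add: m_def field_simps)
  qed
  \<comment> \<open>Together the left conditions say that the orbit is unbounded, the right ones
    that small averages recur at arbitrarily late times. Each set is a union of sets cut out by a
    strict inequality between continuous functions, hence open.\<close>
  define G where "G i = (case i of Inl k \<Rightarrow> {y. \<exists>n. real k < norm ((T ^^ n) y)}
      | Inr k \<Rightarrow> {y. \<exists>N\<ge>k. m y N < 1 / real (Suc k)})" for i :: "nat + nat"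
  have "\<exists>v\<in>Y. \<forall>i. v \<in> G i"
  proof (rule Baire_category_closed[of Y G])
    show "closed Y" by fact
    show "Y \<noteq> {}" using Y subspace_0 by blast
    show "open (G i)" for i
    proof (cases i)
      case (Inl k)
      have "G i = (\<Union>n. {y. real k < norm ((T ^^ n) y)})" by (auto simp: G_def Inl)
      moreover have "open {y. real k < norm ((T ^^ n) y)}" for n
        by (intro open_Collect_less continuous_intros linear_continuous_on bl)
      ultimately show ?thesis by auto
    next
      case (Inr k)
      have "G i = (\<Union>N\<in>{k..}. {y. m y N < 1 / real (Suc k)})" by (auto simp: G_def Inr)
      moreover have "continuous_on UNIV (\<lambda>y. m y N)" for N
        unfolding m_def divide_inverse
        by (intro continuous_intros linear_continuous_on bl)
      then have "open {y. m y N < 1 / real (Suc k)}" for N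
        by (intro open_Collect_less continuous_intros)
      ultimately show ?thesis by auto
    qed
    show "\<exists>z\<in>Y \<inter> G i. dist z y < e" if y: "y \<in> Y" "0 < e" for i y e
    proof (cases i)
      case (Inl k)
      show ?thesis
        using exists_unbounded_orbit_near[OF T Y(1) _ nonlim near0 y, of "real k"] orbit Y(3)
        by (auto simp: G_def Inl)
    next
      case (Inr k)
      \<comment> \<open>\<open>Y0\<close> is dense in \<open>Y\<close>, and all its members have
        small averages at late times.\<close>
      obtain z where "z \<in> Y0" "dist z y < e"
        using y unfolding Y_def closure_approachable by blast
      then show ?thesis using small[of z "1 / real (Suc k)" k] Y(3) by (auto simp: G_def Inr)
    qed
  qed
  then obtain v where v: "v \<in> G i" for i by blast
  show thesis
  proof (rule that[of v])
    fix K
    obtain k where "K < real k" using reals_Archimedean2 by blast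
    then show "\<exists>n. K < norm ((T ^^ n) v)" using v[of "Inl k"] by (auto simp: G_def intro: less_trans)
  next
    fix e :: real assume "0 < e"
    show "\<exists>\<^sub>F N in sequentially. (\<Sum>j=1..N. norm ((T ^^ j) v)) / real N < e"
      unfolding frequently_sequentially
    proof
      fix n0
      obtain k where k: "inverse (real (Suc k)) < e" using reals_Archimedean[OF \<open>0 < e\<close>] by blast
      \<comment> \<open>Taking the index \<open>max k n0\<close> lets one condition give both
        \<open>N \<ge> n0\<close> and an average below \<open>e\<close>.\<close>
      obtain N where N: "max k n0 \<le> N" "m v N < 1 / real (Suc (max k n0))"
        using v[of "Inr (max k n0)"] by (auto simp: G_def)
      have "1 / real (Suc (max k n0)) \<le> inverse (real (Suc k))" by (simp add: field_simps)
      with N k show "\<exists>N\<ge>n0. (\<Sum>j=1..N. norm ((T ^^ j) v)) / real N < e"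
        by (intro exI[of _ N]) (auto simp: m_def)
    qed
  qed
qed

section \<open>From a single vector to a scrambled line\<close>

theorem theorem2p4:
  fixes T :: "'a::banach \<Rightarrow> 'a"
  assumes "bounded_linear T"
    and "mean_Li_Yorke_chaotic T"
  shows "reiteratively_distributionally_chaotic_1_plus T"
proof -
  have lin: "linear (T ^^ n)" for n
    using bounded_linear_funpow[OF assms(1)] bounded_linear.linear by blast
  obtain S where S: "uncountable S" "\<And>x y. x \<in> S \<Longrightarrow> y \<in> S \<Longrightarrow> x \<noteq> y \<Longrightarrow>
      liminf (\<lambda>N. ereal (orbit_mean T x y N)) = 0 \<and> limsup (\<lambda>N. ereal (orbit_mean T x y N)) > 0"
    using assms(2) unfolding mean_Li_Yorke_chaotic_def by blast
  obtain x y where xy: "x \<in> S" "y \<in> S" "x \<noteq> y"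
    using S(1) by (metis countable_empty countable_insert is_singletonI' is_singleton_def)
  have mean: "orbit_mean T x y N = (\<Sum>j=1..N. norm ((T ^^ j) (x - y))) / real N" for N
    by (simp add: orbit_mean_def linear_diff[OF lin])
  \<comment> \<open>The lower limit zero is attained along a subsequence; the positive upper limit
    then excludes convergence of the full averages to zero.\<close>
  obtain r where r: "strict_mono r" "(\<lambda>k. ereal (orbit_mean T x y (r k))) \<longlonglongrightarrow> 0"
    using liminf_subseq_lim[of "\<lambda>N. ereal (orbit_mean T x y N)"] S(2)[OF xy] by (auto simp: o_def)
  have "\<not> (\<lambda>N. orbit_mean T x y N) \<longlonglongrightarrow> 0"
  proof
    assume "(\<lambda>N. orbit_mean T x y N) \<longlonglongrightarrow> 0"
    then have "(\<lambda>N. ereal (orbit_mean T x y N)) \<longlonglongrightarrow> ereal 0" by simp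
    then have "limsup (\<lambda>N. ereal (orbit_mean T x y N)) = ereal 0"
      by (rule lim_imp_Limsup[OF sequentially_bot])
    then show False using S(2)[OF xy] by simp
  qed
  then obtain v where unbounded: "\<And>K. \<exists>n. K < norm ((T ^^ n) v)"
    and small: "\<And>e. 0 < e \<Longrightarrow> \<exists>\<^sub>F N in sequentially. (\<Sum>j=1..N. norm ((T ^^ j) v)) / real N < e"
    using exists_unbounded_orbit_small_averages[OF assms(1) r(1), of "x - y"] r(2)
    by (auto simp: mean zero_ereal_def)
  obtain B where "\<And>x. norm (T x) \<le> norm x * B"
    using bounded_linear.bounded[OF assms(1)] by blast
  \<comment> \<open>Raising the constant to at least 1 makes its powers increasing, as the block
    argument requires.\<close>
  then have B: "norm (T x) \<le> max 1 B * norm x" for x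
    by (smt (verit) mult.commute mult_right_mono norm_ge_zero)
  have "v \<noteq> 0" using unbounded[of 0] linear_0[OF lin] by auto
  \<comment> \<open>Orbit distances between two points of the line are
    \<open>\<bar>s - t\<bar>\<close> times the orbit norms of \<open>v\<close>. A positive factor
    preserves both unboundedness and recurring small averages, so any threshold will do, and
    \<epsilon> = 1 is taken for all pairs.\<close>
  define \<Gamma> where "\<Gamma> = range (\<lambda>t::real. t *\<^sub>R v)"
  have "inj (\<lambda>t::real. t *\<^sub>R v)" using \<open>v \<noteq> 0\<close> by (auto simp: inj_def)
  then have "uncountable \<Gamma>"
    unfolding \<Gamma>_def using uncountable_UNIV_real countable_image_inj_on by blast
  moreover have "BF T x y 1 = 0 \<and> (\<forall>\<delta>>0. F_star T x y \<delta> = 1)"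
    if xy: "x \<in> \<Gamma>" "y \<in> \<Gamma>" "x \<noteq> y" for x y
  proof -
    obtain s t where st: "x = s *\<^sub>R v" "y = t *\<^sub>R v" using xy by (auto simp: \<Gamma>_def)
    define c where "c = \<bar>s - t\<bar>"
    have "0 < c" using st xy by (auto simp: c_def)
    define a where "a j = c * norm ((T ^^ j) v)" for j
    have ct: "close_times T x y \<delta> = {j. a j < \<delta>}" for \<delta>
      by (simp add: close_times_def a_def c_def st linear_scale[OF lin] flip: scaleR_diff_left)
    have "BF T x y 1 = 0"
      unfolding BF_def ct
    proof (rule lower_Banach_dens_eq_0[of "max 1 B"])
      show "a (Suc j) \<le> max 1 B * a j" for j
        using B[of "(T ^^ j) v"] \<open>0 < c\<close> by (simp add: a_def mult.left_commute)
      show "\<exists>j. K < a j" for K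
        using unbounded[of "K / c"] \<open>0 < c\<close> by (simp add: a_def field_simps)
    qed auto
    moreover have "F_star T x y \<delta> = 1" if "0 < \<delta>" for \<delta>
      unfolding F_star_def ct
    proof (rule upper_dens_eq_1)
      show "\<exists>\<^sub>F N in sequentially. (\<Sum>j=1..N. a j) / real N < e" if "0 < e" for e
        using small[of "e / c"] \<open>0 < c\<close> that
        by (simp add: a_def field_simps flip: sum_distrib_left)
    qed (use \<open>0 < c\<close> \<open>0 < \<delta>\<close> in \<open>auto simp: a_def\<close>)
    ultimately show ?thesis by blast
  qed
  ultimately show ?thesis
    unfolding reiteratively_distributionally_chaotic_1_plus_def
    by (intro exI[of _ \<Gamma>] exI[of _ "1::real"]) auto
qed

end
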